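(* Let $p,q$ be positive integers and let $R>r>0$, $a>0$ be real. The S-torus knot $$x(t)=[R+r\cos(qt)]\cos(pt),\quad y(t)=[R+r\cos(qt)]\sin(pt),\quad z(t)=a\sin(qt),\qquad t\in\mathbb{R},$$ does not have singular points.
   Context: The (local) singular points of a curve $x=x(t)$, $y=y(t)$, $z=z(t)$ in $\mathbb{R}^3$ are those points where $\dot x(t)=\dot y(t)=\dot z(t)=0$. *)

theory Defs
  imports "HOL-Analysis.Analysis"
begin

text \<open>Meant for differentiable curves: \<open>deriv\<close> is unspecified where a coordinate function has
  no derivative.\<close>

definition singular_points :: "(real \<Rightarrow> real ^ 3) \<Rightarrow> (real ^ 3) set" where
  "singular_points c =
     {c t | t. deriv (\<lambda>s. c s $ 1) t = 0 \<and> deriv (\<lambda>s. c s $ 2) t = 0 \<and> deriv (\<lambda>s. c s $ 3) t = 0}"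

definition S_torus_knot :: "nat \<Rightarrow> nat \<Rightarrow> real \<Rightarrow> real \<Rightarrow> real \<Rightarrow> real \<Rightarrow> real ^ 3" where
  "S_torus_knot p q R r a t =
     vector [(R + r * cos (real q * t)) * cos (real p * t),
             (R + r * cos (real q * t)) * sin (real p * t),
             a * sin (real q * t)]"

end

theory Submission
  imports Defs
begin

text \<open>
  The projection of the knot to the \<open>xy\<close>-plane is given in polar coordinates by the distance
  \<open>\<rho> = R + r cos(qt)\<close> from the axis and the angle \<open>pt\<close>. Its velocity has angular component
  \<open>\<rho> p\<close>, and \<open>\<rho> \<ge> R - r > 0\<close> because the torus does not meet its axis. So the projection
  never stops turning around the axis, and its velocity cannot vanish.
\<close>

text \<open>Projecting the planar velocity onto the unit vector \<open>(- sin \<theta>, cos \<theta>)\<close> removes the radial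
  part and leaves the angular part \<open>\<rho> \<omega>\<close>.\<close>

lemma angular_velocity_polar:
  fixes \<rho> \<theta> :: "real \<Rightarrow> real"
  assumes "(\<rho> has_real_derivative v) (at t)" and "(\<theta> has_real_derivative \<omega>) (at t)"
  shows "cos (\<theta> t) * deriv (\<lambda>s. \<rho> s * sin (\<theta> s)) t - sin (\<theta> t) * deriv (\<lambda>s. \<rho> s * cos (\<theta> s)) t
    = \<rho> t * \<omega>"
proof -
  have "deriv (\<lambda>s. \<rho> s * cos (\<theta> s)) t = v * cos (\<theta> t) - \<rho> t * \<omega> * sin (\<theta> t)"
    by (rule DERIV_imp_deriv) (auto intro!: derivative_eq_intros assms)
  moreover have "deriv (\<lambda>s. \<rho> s * sin (\<theta> s)) t = v * sin (\<theta> t) + \<rho> t * \<omega> * cos (\<theta> t)"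
    by (rule DERIV_imp_deriv) (auto intro!: derivative_eq_intros assms)
  ultimately have "cos (\<theta> t) * deriv (\<lambda>s. \<rho> s * sin (\<theta> s)) t
      - sin (\<theta> t) * deriv (\<lambda>s. \<rho> s * cos (\<theta> s)) t
    = cos (\<theta> t) * (v * sin (\<theta> t) + \<rho> t * \<omega> * cos (\<theta> t))
      - sin (\<theta> t) * (v * cos (\<theta> t) - \<rho> t * \<omega> * sin (\<theta> t))"
    by (simp only:)
  also have "\<dots> = \<rho> t * \<omega> * ((sin (\<theta> t))\<^sup>2 + (cos (\<theta> t))\<^sup>2)"
    by algebra
  finally show ?thesis
    by simp
qed

theorem proposition14p8:
  fixes p q :: nat and R r a :: real
  assumes "p > 0" and "q > 0"
    and "R > r" and "r > 0" and "a > 0"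
  shows "singular_points (S_torus_knot p q R r a) = {}"
proof -
  define \<rho> where "\<rho> t = R + r * cos (real q * t)" for t
  have nonsingular: "\<not> (deriv (\<lambda>s. S_torus_knot p q R r a s $ 1) t = 0 \<and>
      deriv (\<lambda>s. S_torus_knot p q R r a s $ 2) t = 0)" for t
  proof
    assume "deriv (\<lambda>s. S_torus_knot p q R r a s $ 1) t = 0 \<and>
      deriv (\<lambda>s. S_torus_knot p q R r a s $ 2) t = 0"
    then have "deriv (\<lambda>s. \<rho> s * cos (real p * s)) t = 0"
      and "deriv (\<lambda>s. \<rho> s * sin (real p * s)) t = 0"
      by (simp_all add: S_torus_knot_def vector_3 \<rho>_def)
    moreover have "(\<rho> has_real_derivative - (r * (real q * sin (real q * t)))) (at t)"
      unfolding \<rho>_def by (auto intro!: derivative_eq_intros)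
    moreover have "((\<lambda>s. real p * s) has_real_derivative real p) (at t)"
      by (auto intro!: derivative_eq_intros)
    ultimately have "\<rho> t * real p = 0"
      using angular_velocity_polar[of \<rho> _ t "\<lambda>s. real p * s" "real p"] by simp
    moreover have "\<rho> t > 0"
    proof -
      have "r * (-1) \<le> r * cos (real q * t)"
        using \<open>r > 0\<close> by (intro mult_left_mono) auto
      then show ?thesis
        using \<open>R > r\<close> by (simp add: \<rho>_def)
    qed
    ultimately show False
      using \<open>p > 0\<close> by simp
  qed
  then show ?thesis
    by (auto simp: singular_points_def)
qed

end
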